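(* Let $n\ge1$, $B\in\mathcal{M}_{n\times n}(\mathbb{R})$, and let $(X,d)$ be a complete vector $B$-metric space such that the $B$-metric $d$ is continuous. Let $f\colon X\to\mathbb{R}^n$ be a lower semicontinuous function bounded from below. Assume that for every nonempty closed subset $F\subset X$ and every $\varepsilon>0$ there exists a point $x_{\varepsilon,F}\in F$ such that $$f(x_{\varepsilon,F})\le f(x)+\varepsilon e\quad\text{for all }x\in F,$$ where $e=(1,1,\ldots,1)\in\mathbb{R}^n$. Then, for a given $x_0\in X$, there exist a sequence $(x_k)_{k\ge0}\subset X$ (starting at the given $x_0$) and a point $x^\ast\in X$ such that $x_k\to x^\ast$ as $k\to\infty$, $$f(x^\ast)\le f(x_0)-d(x^\ast,x_0),$$ and, for $x\in X$, $$f(x^\ast)+d(x^\ast,x_k)\ge f(x)+d(x,x_k)\ \text{ for all }k\ge0\quad\text{implies}\quad x=x^\ast.$$ Moreover, for $x\in X$, $$f(x^\ast)\ge f(x)+B\,d(x^\ast,x)+(B-I)\,d(x^\ast,x_k)\ \text{ for all }k\ge0\quad\text{implies}\quad x=x^\ast.$$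
   Context: Vectors in $\mathbb{R}^n$ are columns; inequalities between vectors and convergence of sequences of vectors are understood componentwise; $I$ is the $n\times n$ identity matrix. For a set $X$ and an arbitrary matrix $B\in\mathcal{M}_{n\times n}(\mathbb{R})$, a vector $B$-metric on $X$ is a mapping $d\colon X\times X\to\mathbb{R}^n_+$ ($\mathbb{R}_+=[0,\infty)$) such that for all $u,v,w\in X$: $d(u,v)=0$ if and only if $u=v$; $d(u,v)=d(v,u)$; and $d(u,w)\le B\,(d(u,v)+d(v,w))$. Then $(X,d)$ is called a vector $B$-metric space. A sequence $(x_k)$ converges to $x$ (written $x_k\to x$) if $d(x_k,x)\to 0$; it is Cauchy if $d(x_k,x_p)\to0$ as $k,p\to\infty$; $(X,d)$ is complete if every Cauchy sequence converges to a point of $X$. Topological notions are sequential: a subset $F$ is closed if it contains the limit of every convergent sequence of its points; $d$ is continuous if $x_k\to x$ and $y_k\to y$ imply $d(x_k,y_k)\to d(x,y)$; $f=(f_1,\ldots,f_n)$ is lower semicontinuous if for each $i$, $x_k\to x$ implies $f_i(x)\le\liminf_{k\to\infty} f_i(x_k)$; $f$ is bounded from below if each $f_i$ is bounded from below. *)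

theory Defs
  imports "HOL-Analysis.Analysis"
begin

text \<open>
  The space is a carrier set \<open>X\<close> inside a type, and \<open>d\<close>, \<open>f\<close> are only constrained on \<open>X\<close>.
  The order \<open>\<le>\<close> and the topology of \<open>real ^ 'n\<close> are the componentwise ones.
\<close>

definition vector_B_metric :: "real ^ 'n ^ 'n \<Rightarrow> 'a set \<Rightarrow> ('a \<Rightarrow> 'a \<Rightarrow> real ^ 'n) \<Rightarrow> bool" where
  "vector_B_metric B X d \<longleftrightarrow>
     (\<forall>u\<in>X. \<forall>v\<in>X. 0 \<le> d u v) \<and>
     (\<forall>u\<in>X. \<forall>v\<in>X. d u v = 0 \<longleftrightarrow> u = v) \<and>
     (\<forall>u\<in>X. \<forall>v\<in>X. d u v = d v u) \<and>
     (\<forall>u\<in>X. \<forall>v\<in>X. \<forall>w\<in>X. d u w \<le> B *v (d u v + d v w))"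

definition vconv :: "('a \<Rightarrow> 'a \<Rightarrow> real ^ 'n) \<Rightarrow> (nat \<Rightarrow> 'a) \<Rightarrow> 'a \<Rightarrow> bool" where
  "vconv d s x \<longleftrightarrow> (\<lambda>k. d (s k) x) \<longlonglongrightarrow> 0"

definition vCauchy :: "('a \<Rightarrow> 'a \<Rightarrow> real ^ 'n) \<Rightarrow> (nat \<Rightarrow> 'a) \<Rightarrow> bool" where
  "vCauchy d s \<longleftrightarrow> ((\<lambda>(k, p). d (s k) (s p)) \<longlongrightarrow> 0) (sequentially \<times>\<^sub>F sequentially)"

definition vcomplete :: "'a set \<Rightarrow> ('a \<Rightarrow> 'a \<Rightarrow> real ^ 'n) \<Rightarrow> bool" where
  "vcomplete X d \<longleftrightarrow> (\<forall>s. range s \<subseteq> X \<and> vCauchy d s \<longrightarrow> (\<exists>x\<in>X. vconv d s x))"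

definition vclosed :: "'a set \<Rightarrow> ('a \<Rightarrow> 'a \<Rightarrow> real ^ 'n) \<Rightarrow> 'a set \<Rightarrow> bool" where
  "vclosed X d F \<longleftrightarrow>
     F \<subseteq> X \<and> (\<forall>s. \<forall>x\<in>X. range s \<subseteq> F \<and> vconv d s x \<longrightarrow> x \<in> F)"

definition vmetric_continuous :: "'a set \<Rightarrow> ('a \<Rightarrow> 'a \<Rightarrow> real ^ 'n) \<Rightarrow> bool" where
  "vmetric_continuous X d \<longleftrightarrow>
     (\<forall>s t. \<forall>x\<in>X. \<forall>y\<in>X. range s \<subseteq> X \<and> range t \<subseteq> X \<and> vconv d s x \<and> vconv d t y
        \<longrightarrow> (\<lambda>k. d (s k) (t k)) \<longlonglongrightarrow> d x y)"

text \<open>The limit inferior is taken in the extended reals, since it may be infinite.\<close>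

definition vlsc :: "'a set \<Rightarrow> ('a \<Rightarrow> 'a \<Rightarrow> real ^ 'n) \<Rightarrow> ('a \<Rightarrow> real ^ 'n) \<Rightarrow> bool" where
  "vlsc X d f \<longleftrightarrow>
     (\<forall>i. \<forall>s. \<forall>x\<in>X. range s \<subseteq> X \<and> vconv d s x
        \<longrightarrow> ereal (f x $ i) \<le> liminf (\<lambda>k. ereal (f (s k) $ i)))"

definition vbounded_below :: "'a set \<Rightarrow> ('a \<Rightarrow> real ^ 'n) \<Rightarrow> bool" where
  "vbounded_below X f \<longleftrightarrow> (\<forall>i. bdd_below ((\<lambda>x. f x $ i) ` X))"

end

theory Submission
  imports Defs
begin

text \<open>
  Write \<open>S\<close> for a closed set and call
  \<open>{x \<in> S. f x + d x y \<le> f y}\<close> the descent set of \<open>y\<close> in \<open>S\<close>: the points that lie below \<open>y\<close> by at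
  least their distance to \<open>y\<close>. It contains \<open>y\<close>, since \<open>d y y = 0\<close>, and it is closed, since \<open>f\<close> is
  lower semicontinuous and \<open>d\<close> is continuous (\<open>descent_set_closed\<close>).

  Let \<open>S\<^sub>0\<close> be the descent set of \<open>x0\<close> in \<open>X\<close>. Take for \<open>x\<^sub>k\<^sub>+\<^sub>1\<close> a point of \<open>S\<^sub>k\<close> that minimises \<open>f\<close> on
  \<open>S\<^sub>k\<close> up to \<open>1 / (k + 1)\<close> in all components at once, and for \<open>S\<^sub>k\<^sub>+\<^sub>1\<close> its descent set in \<open>S\<^sub>k\<close>
  (\<open>descent_sequence_exists\<close>). Every \<open>x\<close> in \<open>S\<^sub>k\<^sub>+\<^sub>1\<close> satisfies
  \<open>d x x\<^sub>k\<^sub>+\<^sub>1 \<le> f x\<^sub>k\<^sub>+\<^sub>1 - f x \<le> 1 / (k + 1)\<close>, the second inequality because \<open>x\<close> also lies in \<open>S\<^sub>k\<close>.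
  So the sets \<open>S\<^sub>k\<close> shrink around the points \<open>x\<^sub>k\<close>, as in Cantor's intersection theorem. The points
  form a Cauchy sequence, the limit \<open>xstar\<close> lies in every \<open>S\<^sub>k\<close>, and any common point of all the
  \<open>S\<^sub>k\<close> is a limit of \<open>x\<^sub>k\<close> and hence equals \<open>xstar\<close>.

  The conclusions are now read off. Membership in \<open>S\<^sub>0\<close> is the inequality between \<open>f xstar\<close> and \<open>f x0\<close>.
  If \<open>f x + d x x\<^sub>k \<le> f xstar + d xstar x\<^sub>k\<close> for all \<open>k\<close>, then the right-hand side is at most
  \<open>f x\<^sub>k\<close>, so \<open>x\<close> lies in every \<open>S\<^sub>k\<close> too. The last implication reduces to this one, because
  \<open>d x x\<^sub>k \<le> B *v (d x xstar + d xstar x\<^sub>k)\<close>.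

  The matrix \<open>B\<close> may have negative entries, so \<open>v \<mapsto> B *v v\<close> need not preserve the order. The triangle
  inequality is therefore never applied to upper bounds of distances. Limits are unique because this
  map is continuous at \<open>0\<close>, and the sequence is Cauchy because all points after \<open>x\<^sub>k\<close> lie in \<open>S\<^sub>k\<close> and
  so are close to \<open>x\<^sub>k\<close> itself (\<open>vCauchyI_later_points\<close>).
\<close>

section \<open>Convergence in vector B-metric spaces\<close>

lemma vector_B_metric_nonneg:
  "vector_B_metric B X d \<Longrightarrow> u \<in> X \<Longrightarrow> v \<in> X \<Longrightarrow> 0 \<le> d u v"
  by (simp add: vector_B_metric_def)

lemma vector_B_metric_eq_0_iff:
  "vector_B_metric B X d \<Longrightarrow> u \<in> X \<Longrightarrow> v \<in> X \<Longrightarrow> d u v = 0 \<longleftrightarrow> u = v"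
  by (simp add: vector_B_metric_def)

lemma vector_B_metric_sym:
  "vector_B_metric B X d \<Longrightarrow> u \<in> X \<Longrightarrow> v \<in> X \<Longrightarrow> d u v = d v u"
  by (simp add: vector_B_metric_def)

lemma vector_B_metric_triangle:
  "vector_B_metric B X d \<Longrightarrow> u \<in> X \<Longrightarrow> v \<in> X \<Longrightarrow> w \<in> X \<Longrightarrow> d u w \<le> B *v (d u v + d v w)"
  by (simp add: vector_B_metric_def)

lemma tendsto_0_vec_sandwich:
  fixes g :: "'b \<Rightarrow> real ^ 'n"
  assumes "\<forall>\<^sub>F t in F. 0 \<le> g t \<and> g t \<le> r t *\<^sub>R (\<chi> i. 1)"
    and "(r \<longlongrightarrow> 0) F"
  shows "(g \<longlongrightarrow> 0) F"
proof (rule vec_tendstoI)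
  fix i
  show "((\<lambda>t. g t $ i) \<longlongrightarrow> 0 $ i) F"
    unfolding zero_index
  proof (rule tendsto_sandwich[OF _ _ tendsto_const assms(2)])
    show "\<forall>\<^sub>F t in F. 0 \<le> g t $ i" and "\<forall>\<^sub>F t in F. g t $ i \<le> r t"
      using assms(1) by (auto simp: less_eq_vec_def elim!: eventually_mono)
  qed
qed

lemma vconv_unique:
  assumes metric: "vector_B_metric B X d"
    and "range s \<subseteq> X" "x \<in> X" "y \<in> X" "vconv d s x" "vconv d s y"
  shows "x = y"
proof -
  have sX: "s k \<in> X" for k using assms(2) by auto
  have "(\<lambda>k. d x (s k) + d (s k) y) \<longlonglongrightarrow> 0 + 0"
    using assms(5,6) vector_B_metric_sym[OF metric sX \<open>x \<in> X\<close>]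
    by (intro tendsto_add) (simp_all add: vconv_def)
  then have lim: "(\<lambda>k. B *v (d x (s k) + d (s k) y)) \<longlonglongrightarrow> B *v (0 + 0)"
    by (rule bounded_linear.tendsto[OF matrix_vector_mul_bounded_linear])
  have "d x y \<le> 0"
    unfolding less_eq_vec_def
  proof
    fix i
    have "(\<lambda>k. (B *v (d x (s k) + d (s k) y)) $ i) \<longlonglongrightarrow> 0"
      using tendsto_vec_nth[OF lim, of i] by simp
    moreover have "d x y $ i \<le> (B *v (d x (s k) + d (s k) y)) $ i" for k
      using vector_B_metric_triangle[OF metric \<open>x \<in> X\<close> sX \<open>y \<in> X\<close>]
      by (simp add: less_eq_vec_def)
    ultimately show "d x y $ i \<le> 0 $ i"
      by (simp add: LIMSEQ_le_const)
  qed
  then have "d x y = 0"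
    using vector_B_metric_nonneg[OF metric \<open>x \<in> X\<close> \<open>y \<in> X\<close>] by (rule antisym)
  then show ?thesis
    using vector_B_metric_eq_0_iff[OF metric \<open>x \<in> X\<close> \<open>y \<in> X\<close>] by simp
qed

text \<open>
  Whichever of two indices is smaller controls the distance, so one-sided bounds suffice and the
  triangle inequality is avoided. The condition \<open>0 < k\<close> leaves out the starting point, which is
  prescribed and not an approximate minimiser.
\<close>

lemma vCauchyI_later_points:
  assumes metric: "vector_B_metric B X d"
    and sX: "\<And>k. s k \<in> X"
    and "r \<longlonglongrightarrow> 0"
    and later: "\<And>k p. 0 < k \<Longrightarrow> k \<le> p \<Longrightarrow> d (s p) (s k) \<le> r k *\<^sub>R (\<chi> i. 1)"
  shows "vCauchy d s"
  unfolding vCauchy_def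
proof (rule tendsto_0_vec_sandwich)
  have "((\<lambda>q. r (fst q)) \<longlongrightarrow> 0) (sequentially \<times>\<^sub>F sequentially)"
    and "((\<lambda>q. r (snd q)) \<longlongrightarrow> 0) (sequentially \<times>\<^sub>F sequentially)"
    by (rule filterlim_compose[OF \<open>r \<longlonglongrightarrow> 0\<close>] filterlim_fst filterlim_snd)+
  from tendsto_add[OF this]
  show "((\<lambda>q. r (fst q) + r (snd q)) \<longlongrightarrow> 0) (sequentially \<times>\<^sub>F sequentially)"
    by simp
next
  have bound: "0 \<le> d (s k) (s p) \<and> d (s k) (s p) \<le> (r k + r p) *\<^sub>R (\<chi> i. 1)"
    if "0 < k" "0 < p" for k p
  proof -
    have "0 \<le> d (s k) (s k)" "0 \<le> d (s p) (s p)" "0 \<le> d (s k) (s p)"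
      and sym: "d (s k) (s p) = d (s p) (s k)"
      using vector_B_metric_nonneg[OF metric sX sX] vector_B_metric_sym[OF metric sX sX] by auto
    \<comment> \<open>The smaller index gives the bound; the other term only has to be nonnegative.\<close>
    then have "0 \<le> r k" "0 \<le> r p"
      using later[of k k] later[of p p] that by (auto simp: less_eq_vec_def intro: order_trans)
    moreover have "d (s k) (s p) \<le> r k *\<^sub>R (\<chi> i. 1) \<or> d (s k) (s p) \<le> r p *\<^sub>R (\<chi> i. 1)"
      using later[of k p] later[of p k] that sym by (cases "k \<le> p") auto
    ultimately have "d (s k) (s p) \<le> (r k + r p) *\<^sub>R (\<chi> i. 1)"
      by (force simp: less_eq_vec_def intro: order_trans add_increasing add_increasing2)
    then show ?thesis using \<open>0 \<le> d (s k) (s p)\<close> by simp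
  qed
  have "\<forall>\<^sub>F q in sequentially \<times>\<^sub>F sequentially. 0 < fst q \<and> 0 < snd q"
    unfolding eventually_prod_filter fst_conv snd_conv
    using eventually_gt_at_top[of "0::nat"] by blast
  then show "\<forall>\<^sub>F q in sequentially \<times>\<^sub>F sequentially.
      0 \<le> (case q of (k, p) \<Rightarrow> d (s k) (s p)) \<and>
      (case q of (k, p) \<Rightarrow> d (s k) (s p)) \<le> (r (fst q) + r (snd q)) *\<^sub>R (\<chi> i. 1)"
    by (rule eventually_mono) (auto intro: bound[THEN conjunct1] bound[THEN conjunct2])
qed

section \<open>Descent sets and descent sequences\<close>

definition descent_set ::
  "('a \<Rightarrow> 'a \<Rightarrow> real ^ 'n) \<Rightarrow> ('a \<Rightarrow> real ^ 'n) \<Rightarrow> 'a set \<Rightarrow> 'a \<Rightarrow> 'a set" where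
  "descent_set d f F y = {x \<in> F. f x + d x y \<le> f y}"

lemma descent_set_closed:
  assumes metric: "vector_B_metric B X d" and cont: "vmetric_continuous X d"
    and lsc: "vlsc X d f" and closed: "vclosed X d F" and "y \<in> X"
  shows "vclosed X d (descent_set d f F y)"
  unfolding vclosed_def
proof (intro conjI allI ballI impI)
  show "descent_set d f F y \<subseteq> X"
    using closed by (auto simp: vclosed_def descent_set_def)
next
  fix s x
  assume "x \<in> X" and *: "range s \<subseteq> descent_set d f F y \<and> vconv d s x"
  then have "range s \<subseteq> F" and conv: "vconv d s x" and below: "f (s k) + d (s k) y \<le> f y" for k
    by (auto simp: descent_set_def)
  then have "x \<in> F" "range s \<subseteq> X"
    using closed \<open>x \<in> X\<close> unfolding vclosed_def by blast+
  have "vconv d (\<lambda>_. y) y"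
    using vector_B_metric_eq_0_iff[OF metric \<open>y \<in> X\<close> \<open>y \<in> X\<close>] by (simp add: vconv_def)
  moreover have "range (\<lambda>_::nat. y) \<subseteq> X" using \<open>y \<in> X\<close> by auto
  ultimately have dlim: "(\<lambda>k. d (s k) y) \<longlonglongrightarrow> d x y"
    using cont[unfolded vmetric_continuous_def, rule_format, of x y s "\<lambda>_. y"]
      \<open>x \<in> X\<close> \<open>y \<in> X\<close> \<open>range s \<subseteq> X\<close> conv by simp
  have "f x + d x y \<le> f y"
    unfolding less_eq_vec_def
  proof
    fix i
    have "ereal (f x $ i) \<le> liminf (\<lambda>k. ereal (f (s k) $ i))"
      using lsc \<open>x \<in> X\<close> \<open>range s \<subseteq> X\<close> conv by (simp add: vlsc_def)
    also have "\<dots> \<le> liminf (\<lambda>k. ereal (f y $ i - d (s k) y $ i))"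
      using below by (intro Liminf_mono always_eventually) (auto simp: less_eq_vec_def le_diff_eq)
    also have "\<dots> = ereal (f y $ i - d x y $ i)"
    proof (rule lim_imp_Liminf)
      show "(\<lambda>k. ereal (f y $ i - d (s k) y $ i)) \<longlonglongrightarrow> ereal (f y $ i - d x y $ i)"
        by (intro tendsto_intros dlim tendsto_vec_nth[OF dlim])
    qed simp
    finally show "(f x + d x y) $ i \<le> f y $ i" by simp
  qed
  with \<open>x \<in> F\<close> show "x \<in> descent_set d f F y" by (simp add: descent_set_def)
qed

text \<open>
  The point \<open>s (Suc k)\<close> and the set \<open>S (Suc k)\<close> are built together, by dependent choice on pairs,
  since the set in which the next point is sought depends on all the previous points.
\<close>

lemma descent_sequence_exists:
  fixes d :: "'a \<Rightarrow> 'a \<Rightarrow> real ^ 'n"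
  assumes metric: "vector_B_metric B X d" and cont: "vmetric_continuous X d"
    and lsc: "vlsc X d f"
    and approx_min: "\<And>F \<epsilon>. \<lbrakk>F \<noteq> {}; vclosed X d F; (\<epsilon>::real) > 0\<rbrakk> \<Longrightarrow>
           \<exists>z\<in>F. \<forall>x\<in>F. f z \<le> f x + \<epsilon> *\<^sub>R (\<chi> i. 1)"
    and "x0 \<in> X"
  obtains s S where "s 0 = x0" "S 0 = descent_set d f X x0"
    and "\<And>k. S (Suc k) = descent_set d f (S k) (s (Suc k))"
    and "\<And>k. vclosed X d (S k)" "\<And>k. s k \<in> S k"
    and "\<And>k x. x \<in> S k \<Longrightarrow> f (s (Suc k)) \<le> f x + inverse (real (Suc k)) *\<^sub>R (\<chi> i. 1)"
proof -
  define good :: "nat \<Rightarrow> 'a \<times> 'a set \<Rightarrow> bool" where "good k q \<longleftrightarrow> fst q \<in> snd q \<and> vclosed X d (snd q) \<and>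
      (k = 0 \<longrightarrow> q = (x0, descent_set d f X x0))" for k q
  define step :: "nat \<Rightarrow> 'a \<times> 'a set \<Rightarrow> 'a \<times> 'a set \<Rightarrow> bool" where
    "step k q q' \<longleftrightarrow> snd q' = descent_set d f (snd q) (fst q') \<and>
      (\<forall>x\<in>snd q. f (fst q') \<le> f x + inverse (real (Suc k)) *\<^sub>R (\<chi> i. 1))" for k q q'
  have self_mem: "y \<in> descent_set d f F y" if "y \<in> F" "y \<in> X" for y F
    using that vector_B_metric_eq_0_iff[OF metric, of y y] by (simp add: descent_set_def)
  have "vclosed X d X" by (auto simp: vclosed_def)
  then have start: "good 0 (x0, descent_set d f X x0)"
    using descent_set_closed[OF metric cont lsc] self_mem \<open>x0 \<in> X\<close> by (simp add: good_def)
  have next_pair: "\<exists>q'. good (Suc k) q' \<and> step k q q'" if "good k q" for q k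
  proof -
    have "snd q \<noteq> {}" "vclosed X d (snd q)" using that by (auto simp: good_def)
    then obtain z where z: "z \<in> snd q"
        "\<forall>x\<in>snd q. f z \<le> f x + inverse (real (Suc k)) *\<^sub>R (\<chi> i. 1)"
      using approx_min[of "snd q" "inverse (real (Suc k))"] by auto
    then have "z \<in> X" using \<open>vclosed X d (snd q)\<close> by (auto simp: vclosed_def)
    then have "good (Suc k) (z, descent_set d f (snd q) z)" "step k q (z, descent_set d f (snd q) z)"
      using z descent_set_closed[OF metric cont lsc \<open>vclosed X d (snd q)\<close>] self_mem
      by (auto simp: good_def step_def)
    then show ?thesis by blast
  qed
  obtain h where h: "\<And>k. good k (h k)" "\<And>k. step k (h k) (h (Suc k))"
    using dependent_nat_choice[of good step] start next_pair by metis
  show thesis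
    using h[unfolded good_def step_def]
    by (intro that[of "fst \<circ> h" "snd \<circ> h"]) auto
qed

section \<open>The variational principle\<close>

theorem theorem4p6:
  fixes B :: "real ^ 'n ^ 'n"
    and X :: "'a set"
    and d :: "'a \<Rightarrow> 'a \<Rightarrow> real ^ 'n"
    and f :: "'a \<Rightarrow> real ^ 'n"
    and x0 :: 'a
  assumes "vector_B_metric B X d"
    and "vcomplete X d"
    and "vmetric_continuous X d"
    and "vlsc X d f"
    and "vbounded_below X f"
    and "\<And>F \<epsilon>. \<lbrakk>F \<noteq> {}; vclosed X d F; (\<epsilon>::real) > 0\<rbrakk> \<Longrightarrow>
           \<exists>z\<in>F. \<forall>x\<in>F. f z \<le> f x + \<epsilon> *\<^sub>R (\<chi> i. 1)"
    and "x0 \<in> X"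
  shows "\<exists>s :: nat \<Rightarrow> 'a. \<exists>xstar\<in>X.
           range s \<subseteq> X \<and> s 0 = x0 \<and> vconv d s xstar \<and>
           f xstar \<le> f x0 - d xstar x0 \<and>
           (\<forall>x\<in>X. (\<forall>k. f xstar + d xstar (s k) \<ge> f x + d x (s k)) \<longrightarrow> x = xstar) \<and>
           (\<forall>x\<in>X. (\<forall>k. f xstar \<ge> f x + B *v d xstar x + (B - mat 1) *v d xstar (s k))
              \<longrightarrow> x = xstar)"
proof -
  note metric = assms(1)
  obtain s S where s0: "s 0 = x0" and S0: "S 0 = descent_set d f X x0"
    and SSuc: "\<And>k. S (Suc k) = descent_set d f (S k) (s (Suc k))"
    and closed: "\<And>k. vclosed X d (S k)" and sS: "\<And>k. s k \<in> S k"
    and approx_min: "\<And>k x. x \<in> S k \<Longrightarrow>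
        f (s (Suc k)) \<le> f x + inverse (real (Suc k)) *\<^sub>R (\<chi> i. 1)"
    by (rule descent_sequence_exists[OF metric assms(3,4) _ assms(7)];
        (erule (2) assms(6) | rule that; assumption))
  have sX: "s k \<in> X" for k
    using sS[of k] closed[of k] by (auto simp: vclosed_def)
  have "S (Suc k) \<subseteq> S k" for k
    by (auto simp: SSuc descent_set_def)
  then have S_mono: "S p \<subseteq> S k" if "k \<le> p" for k p
    using that by (rule lift_Suc_antimono_le)
  have below: "f x + d x (s k) \<le> f (s k)" if "x \<in> S k" for x k
    using that by (cases k) (auto simp: S0 s0 SSuc descent_set_def)
  have in_S: "x \<in> S k" if "x \<in> X" "\<And>k. f x + d x (s k) \<le> f (s k)" for x k
    using that by (induction k) (auto simp: S0 SSuc descent_set_def simp flip: s0)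
  have shrink: "d x (s k) \<le> inverse (real k) *\<^sub>R (\<chi> i. 1)" if "x \<in> S k" "0 < k" for x k
  proof -
    obtain m where m: "k = Suc m" using \<open>0 < k\<close> by (cases k) auto
    have "x \<in> S m" using \<open>x \<in> S k\<close> S_mono[of m k] m by auto
    from add_mono[OF below[OF \<open>x \<in> S k\<close>] approx_min[OF this]]
    show ?thesis unfolding m by (simp add: less_eq_vec_def algebra_simps)
  qed
  have "vCauchy d s"
  proof (rule vCauchyI_later_points[OF metric sX lim_inverse_n])
    show "d (s p) (s k) \<le> inverse (real k) *\<^sub>R (\<chi> i. 1)" if "0 < k" "k \<le> p" for k p
      using shrink[of "s p" k] sS[of p] S_mono[OF \<open>k \<le> p\<close>] \<open>0 < k\<close> by blast
  qed
  then obtain xstar where xstar: "xstar \<in> X" and conv: "vconv d s xstar"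
    using assms(2) sX unfolding vcomplete_def by blast
  have xstar_S: "xstar \<in> S k" for k
  proof -
    \<comment> \<open>Only the tail from \<open>k\<close> on lies in \<open>S k\<close>, so closedness is applied to the shifted sequence.\<close>
    have "range (\<lambda>p. s (p + k)) \<subseteq> S k"
      using sS S_mono le_add2 by blast
    moreover have "vconv d (\<lambda>p. s (p + k)) xstar"
      using conv unfolding vconv_def by (rule LIMSEQ_ignore_initial_segment)
    ultimately show ?thesis
      using closed[of k] xstar unfolding vclosed_def by blast
  qed
  have unique: "x = xstar" if "x \<in> X" "\<And>k. x \<in> S k" for x
  proof (rule vconv_unique[OF metric _ \<open>x \<in> X\<close> xstar _ conv])
    show "range s \<subseteq> X" using sX by auto
    have "\<forall>\<^sub>F k in sequentially. 0 \<le> d (s k) x \<and> d (s k) x \<le> inverse (real k) *\<^sub>R (\<chi> i. 1)"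
      using eventually_gt_at_top[of 0]
    proof eventually_elim
      case (elim k)
      then show ?case
        using shrink[OF that(2)] vector_B_metric_nonneg[OF metric sX \<open>x \<in> X\<close>]
          vector_B_metric_sym[OF metric sX \<open>x \<in> X\<close>] by simp
    qed
    then show "vconv d s x"
      unfolding vconv_def by (rule tendsto_0_vec_sandwich) (rule lim_inverse_n)
  qed
  have strict: "x = xstar"
    if "x \<in> X" "\<And>k. f x + d x (s k) \<le> f xstar + d xstar (s k)" for x
  proof (rule unique[OF \<open>x \<in> X\<close> in_S[OF \<open>x \<in> X\<close>]])
    show "f x + d x (s k) \<le> f (s k)" for k
      using that(2) below[OF xstar_S] by (rule order_trans)
  qed
  have strict_matrix: "x = xstar"
    if "x \<in> X" and le: "\<And>k. f x + B *v d xstar x + (B - mat 1) *v d xstar (s k) \<le> f xstar" for x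
  proof (rule strict[OF \<open>x \<in> X\<close>])
    fix k
    have "d x (s k) \<le> B *v d xstar x + B *v d xstar (s k)"
      using vector_B_metric_triangle[OF metric \<open>x \<in> X\<close> xstar sX[of k]]
        vector_B_metric_sym[OF metric \<open>x \<in> X\<close> xstar]
      by (simp add: matrix_vector_right_distrib)
    from add_mono[OF this le[of k]]
    show "f x + d x (s k) \<le> f xstar + d xstar (s k)"
      by (simp add: less_eq_vec_def matrix_vector_mult_diff_rdistrib algebra_simps)
  qed
  have "f xstar \<le> f x0 - d xstar x0"
    using below[OF xstar_S[of 0]] s0 by (simp add: le_diff_eq)
  with s0 sX xstar conv strict strict_matrix show ?thesis
    by (intro exI[of _ s] bexI[of _ xstar]) auto
qed

end
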